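(* Let $\Sigma$ be a compact real 2-manifold without boundary, let $l \leq 2$ and let $G$ be a $(2,l)$-tight $\Sigma$-graph. If $H$ is a subgraph of $G$ and $F$ is a face of $H$, then $\gamma(H \cup \mathrm{int}_G(F)) \leq \gamma(H)$.
   Context: Graphs are finite undirected multigraphs (loops and parallel edges allowed). A $\Sigma$-graph is a pair $G=(\Gamma,\varphi)$ where $\Gamma$ is a graph and $\varphi:|\Gamma|\to\Sigma$ is a continuous embedding of the geometric realisation of $\Gamma$. Subgraphs, unions and intersections of $\Sigma$-graphs refer to the underlying graphs, with the restricted embedding. A face of a $\Sigma$-graph is a connected component of the complement in $\Sigma$ of the image of the embedding. For a graph $H$, $\gamma(H)=2|V(H)|-|E(H)|$. For $l\le 2$, a graph is $(2,l)$-sparse if $\gamma(H')\ge l$ for every nonempty subgraph $H'$, and $(2,l)$-tight if it is $(2,l)$-sparse and $\gamma$ of the whole graph equals $l$. For a subgraph $H$ of $G$ and a face $F$ of $H$, $\mathrm{int}_G(F)$ is the subgraph of $G$ consisting of all vertices and edges of $G$ lying in the topological closure $\overline F$ of $F$ in $\Sigma$.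
   Formalization: The subgraph H is required to be nonempty when l > 0; for empty H and l = 1, 2 the claim fails (e.g. G a single vertex on the sphere, l = 2, F = Σ gives 2 ≤ 0). For l ≤ 0 the empty H is allowed. *)

theory Defs
  imports "HOL-Analysis.Analysis" "HOL-Library.Uprod"
begin

section \<open>Finite undirected multigraphs\<close>

text \<open>A loop at \<open>v\<close> is an edge \<open>e\<close> with \<open>ends G e = Upair v v\<close>.\<close>

record ('v, 'e) mgraph =
  verts :: "'v set"
  edges :: "'e set"
  ends :: "'e \<Rightarrow> 'v uprod"

definition multigraph :: "('v, 'e) mgraph \<Rightarrow> bool" where
  "multigraph G \<longleftrightarrow>
     finite (verts G) \<and> finite (edges G) \<and> (\<forall>e\<in>edges G. set_uprod (ends G e) \<subseteq> verts G)"

definition subgraph :: "('v, 'e) mgraph \<Rightarrow> ('v, 'e) mgraph \<Rightarrow> bool" where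
  "subgraph H G \<longleftrightarrow>
     multigraph H \<and> verts H \<subseteq> verts G \<and> edges H \<subseteq> edges G \<and>
     (\<forall>e\<in>edges H. ends H e = ends G e)"

definition graph_union :: "('v, 'e) mgraph \<Rightarrow> ('v, 'e) mgraph \<Rightarrow> ('v, 'e) mgraph" where
  "graph_union H K =
     \<lparr>verts = verts H \<union> verts K, edges = edges H \<union> edges K,
      ends = (\<lambda>e. if e \<in> edges H then ends H e else ends K e)\<rparr>"

definition gamma :: "('v, 'e) mgraph \<Rightarrow> int" where
  "gamma G = 2 * int (card (verts G)) - int (card (edges G))"

definition sparse :: "int \<Rightarrow> ('v, 'e) mgraph \<Rightarrow> bool" where
  "sparse l G \<longleftrightarrow> (\<forall>H. subgraph H G \<and> verts H \<noteq> {} \<longrightarrow> l \<le> gamma H)"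

definition tight :: "int \<Rightarrow> ('v, 'e) mgraph \<Rightarrow> bool" where
  "tight l G \<longleftrightarrow> sparse l G \<and> gamma G = l"

section \<open>Geometric realisation\<close>

text \<open>
  The realisation is the quotient of the disjoint union of the discrete space \<open>verts G\<close> and
  of \<open>edges G \<times> [0,1]\<close> that glues the two ends of each copy of \<open>[0,1]\<close> to the end vertices of the
  edge. Each class is represented by a vertex \<open>Inl v\<close> or by a point \<open>Inr (e, t)\<close> with \<open>0 < t < 1\<close>.
  The parametrisation of an edge needs an order on its two ends; an arbitrary one is chosen, depending
  only on the unordered pair of ends, so that the points of a subgraph are points of the graph.
\<close>

definition orient :: "'v uprod \<Rightarrow> 'v \<times> 'v" where
  "orient u = (SOME p. Upair (fst p) (snd p) = u)"

fun glue :: "('v, 'e) mgraph \<Rightarrow> 'v + 'e \<times> real \<Rightarrow> 'v + 'e \<times> real" where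
  "glue G (Inl v) = Inl v"
| "glue G (Inr (e, t)) =
     (if t = 0 then Inl (fst (orient (ends G e)))
      else if t = 1 then Inl (snd (orient (ends G e)))
      else Inr (e, t))"

definition points :: "('v, 'e) mgraph \<Rightarrow> ('v + 'e \<times> real) set" where
  "points G = Inl ` verts G \<union> Inr ` (edges G \<times> {0<..<1})"

definition realisation :: "('v, 'e) mgraph \<Rightarrow> ('v + 'e \<times> real) topology" where
  "realisation G = topology (\<lambda>U. U \<subseteq> points G \<and>
     openin (discrete_topology (verts G)) {v \<in> verts G. glue G (Inl v) \<in> U} \<and>
     openin (prod_topology (discrete_topology (edges G)) (top_of_set {0..1}))
       {x \<in> edges G \<times> {0..1}. glue G (Inr x) \<in> U})"

definition edge_points :: "('v, 'e) mgraph \<Rightarrow> 'e \<Rightarrow> ('v + 'e \<times> real) set" where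
  "edge_points G e = (\<lambda>t. glue G (Inr (e, t))) ` {0..1}"

lemma openin_realisation:
  "openin (realisation G) U \<longleftrightarrow> U \<subseteq> points G \<and>
     openin (discrete_topology (verts G)) {v \<in> verts G. glue G (Inl v) \<in> U} \<and>
     openin (prod_topology (discrete_topology (edges G)) (top_of_set {0..1}))
       {x \<in> edges G \<times> {0..1}. glue G (Inr x) \<in> U}"
proof -
  let ?E = "prod_topology (discrete_topology (edges G)) (top_of_set {0..1::real})"
  let ?A = "\<lambda>U. {x \<in> edges G \<times> {0..1}. glue G (Inr x) \<in> U}"
  have "istopology (\<lambda>U. U \<subseteq> points G \<and>
     openin (discrete_topology (verts G)) {v \<in> verts G. glue G (Inl v) \<in> U} \<and> openin ?E (?A U))"
    (is "istopology ?P")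
    unfolding istopology_def
  proof (intro conjI allI impI)
    fix S T assume ST: "?P S" "?P T"
    have "?A (S \<inter> T) = ?A S \<inter> ?A T" by auto
    then have "openin ?E (?A (S \<inter> T))"
      using ST by (simp only: openin_Int)
    then show "S \<inter> T \<subseteq> points G"
      "openin (discrete_topology (verts G)) {v \<in> verts G. glue G (Inl v) \<in> S \<inter> T}"
      "openin ?E (?A (S \<inter> T))"
      using ST by auto
  next
    fix \<K> assume K: "\<forall>K\<in>\<K>. ?P K"
    have "?A (\<Union>\<K>) = (\<Union>K\<in>\<K>. ?A K)" by auto
    moreover have "openin ?E (\<Union>K\<in>\<K>. ?A K)"
      using K by (intro openin_Union) auto
    ultimately show "\<Union>\<K> \<subseteq> points G"
      "openin (discrete_topology (verts G)) {v \<in> verts G. glue G (Inl v) \<in> \<Union>\<K>}"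
      "openin ?E (?A (\<Union>\<K>))"
      using K by auto
  qed
  then show ?thesis
    unfolding realisation_def by (simp add: topology_inverse')
qed

lemma Upair_orient: "Upair (fst (orient u)) (snd (orient u)) = u"
  unfolding orient_def
proof (rule someI_ex)
  show "\<exists>p. Upair (fst p) (snd p) = u"
    by (cases u) (auto intro: exI[of _ "(a, b)" for a b])
qed

lemma glue_in_points:
  assumes "multigraph G" "e \<in> edges G" "t \<in> {0..1}"
  shows "glue G (Inr (e, t)) \<in> points G"
proof -
  have "set_uprod (ends G e) = {fst (orient (ends G e)), snd (orient (ends G e))}"
    by (metis Upair_orient set_uprod_simps)
  then show ?thesis
    using assms by (auto simp: multigraph_def points_def image_iff)
qed

lemma topspace_realisation:
  assumes "multigraph G"
  shows "topspace (realisation G) = points G"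
proof -
  have "{x \<in> edges G \<times> {0..1}. glue G (Inr x) \<in> points G} =
      topspace (prod_topology (discrete_topology (edges G)) (top_of_set {0..1}))"
    using glue_in_points[OF assms] by auto
  then have "openin (realisation G) (points G)"
    unfolding openin_realisation by (auto simp: openin_prod_Times_iff)
  then show ?thesis
    using openin_subset openin_realisation[of G "topspace (realisation G)"] by blast
qed

section \<open>Surfaces, surface graphs and faces\<close>

text \<open>Connectedness is not required.\<close>

definition closed_surface :: "'a topology \<Rightarrow> bool" where
  "closed_surface S \<longleftrightarrow>
     compact_space S \<and> Hausdorff_space S \<and>
     (\<exists>\<B>. countable \<B> \<and> (\<forall>B\<in>\<B>. openin S B) \<and>
        (\<forall>U x. openin S U \<and> x \<in> U \<longrightarrow> (\<exists>B\<in>\<B>. x \<in> B \<and> B \<subseteq> U))) \<and>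
     (\<forall>x\<in>topspace S. \<exists>U. openin S U \<and> x \<in> U \<and>
        (\<exists>W :: (real^2) set. open W \<and> subtopology S U homeomorphic_space top_of_set W))"

definition surface_graph ::
  "'a topology \<Rightarrow> ('v, 'e) mgraph \<Rightarrow> ('v + 'e \<times> real \<Rightarrow> 'a) \<Rightarrow> bool" where
  "surface_graph S G \<phi> \<longleftrightarrow> multigraph G \<and> embedding_map (realisation G) S \<phi>"

definition faces ::
  "'a topology \<Rightarrow> ('v, 'e) mgraph \<Rightarrow> ('v + 'e \<times> real \<Rightarrow> 'a) \<Rightarrow> 'a set set" where
  "faces S H \<phi> = connected_components_of (subtopology S (topspace S - \<phi> ` points H))"

definition int_graph ::
  "'a topology \<Rightarrow> ('v, 'e) mgraph \<Rightarrow> ('v + 'e \<times> real \<Rightarrow> 'a) \<Rightarrow> 'a set \<Rightarrow> ('v, 'e) mgraph" where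
  "int_graph S G \<phi> F =
     \<lparr>verts = {v \<in> verts G. \<phi> (Inl v) \<in> S closure_of F},
      edges = {e \<in> edges G. \<phi> ` edge_points G e \<subseteq> S closure_of F},
      ends = ends G\<rparr>"

end

theory Submission
  imports Defs
begin

text \<open>
  Let \<open>L\<close> be \<open>G\<close> with the vertices and edges of \<open>int_graph S G \<phi> F\<close> not in \<open>H\<close> removed. Then \<open>L\<close> is a
  graph: a removed vertex \<open>v\<close> lies in \<open>F\<close> itself, so for any edge at \<open>v\<close> not in \<open>H\<close>, the edge without
  its other end is connected and avoids \<open>H\<close>; hence it lies in \<open>F\<close>, and the edge has been removed too.
  Passing from \<open>H\<close> to its union with the interior graph adds exactly what passing from \<open>L\<close> to \<open>G\<close> adds,
  so \<open>gamma\<close> changes by \<open>gamma G - gamma L = l - gamma L\<close>, which sparsity makes nonpositive.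
\<close>

text \<open>The realisation carries the quotient topology, so an open set pulls back to an open
  subset of \<open>edges G \<times> {0..1}\<close>; the path is the slice at \<open>e\<close>
  followed by the gluing.\<close>

lemma continuous_map_glue_edge:
  assumes "multigraph G" "e \<in> edges G"
  shows "continuous_map (top_of_set {0..1}) (realisation G) (\<lambda>t. glue G (Inr (e, t)))"
  unfolding continuous_map_def
proof (intro conjI allI impI)
  show "(\<lambda>t. glue G (Inr (e, t))) \<in> topspace (top_of_set {0..1}) \<rightarrow> topspace (realisation G)"
    using glue_in_points[OF assms] by (simp add: topspace_realisation[OF assms(1)])
next
  fix U assume "openin (realisation G) U"
  then have "openin (prod_topology (discrete_topology (edges G)) (top_of_set {0..1}))
       {x \<in> edges G \<times> {0..1}. glue G (Inr x) \<in> U}" (is "openin ?E ?A")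
    by (simp add: openin_realisation)
  moreover have "continuous_map (top_of_set {0..1}) ?E (\<lambda>t. (e, t))"
    using assms(2) by (intro continuous_map_pairedI) auto
  ultimately have "openin (top_of_set {0..1}) {t \<in> topspace (top_of_set {0..1}). (e, t) \<in> ?A}"
    by (rule openin_continuous_map_preimage[rotated])
  moreover have "{t \<in> topspace (top_of_set {0..1}). (e, t) \<in> ?A} =
      {t \<in> topspace (top_of_set {0..1}). glue G (Inr (e, t)) \<in> U}"
    using assms(2) by auto
  ultimately show "openin (top_of_set {0..1})
      {t \<in> topspace (top_of_set {0..1}). glue G (Inr (e, t)) \<in> U}"
    by simp
qed

text \<open>A connected component is closed in the complement of the drawing of \<open>H\<close>, so
  \<open>F\<close> gains new closure points only on that drawing.\<close>

lemma face_closure_diff_subset: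
  assumes "F \<in> faces S H \<phi>"
  shows "S closure_of F - \<phi> ` points H \<subseteq> F"
proof -
  let ?X = "subtopology S (topspace S - \<phi> ` points H)"
  have "closedin ?X F"
    using assms by (simp add: faces_def closedin_connected_components_of)
  then have "?X closure_of F = F"
    by (rule closure_of_closedin)
  moreover have "F \<subseteq> topspace S - \<phi> ` points H"
    using \<open>closedin ?X F\<close> closedin_subset by fastforce
  ultimately have "(topspace S - \<phi> ` points H) \<inter> S closure_of F = F"
    by (simp add: closure_of_subtopology Int_absorb1)
  then show ?thesis
    using closure_of_subset_topspace[of S F] by blast
qed

lemma path_closure_subset_face_closure:
  assumes g: "continuous_map (top_of_set {0..1::real}) S g"
    and F: "F \<in> faces S H \<phi>"
    and J: "connected J" "J \<subseteq> {0..1}" "{0..1} \<subseteq> closure J"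
    and avoid: "g ` J \<inter> \<phi> ` points H = {}"
    and meet: "g ` J \<inter> F \<noteq> {}"
  shows "g ` {0..1} \<subseteq> S closure_of F"
proof -
  have "connectedin (top_of_set {0..1}) J"
    using J by (simp add: connectedin_subtopology)
  then have conn: "connectedin S (g ` J)"
    using g connectedin_continuous_map_image by blast
  then have "connectedin (subtopology S (topspace S - \<phi> ` points H)) (g ` J)"
    using avoid connectedin_subset_topspace[OF conn] by (auto simp: connectedin_subtopology)
  then have "g ` J \<subseteq> F"
    using F meet unfolding faces_def
    by (metis connected_components_of_maximal disjnt_def Int_commute)
  moreover have "g ` (top_of_set {0..1} closure_of J) \<subseteq> S closure_of (g ` J)"
    using g by (rule continuous_map_image_closure_subset)
  moreover have "top_of_set {0..1} closure_of J = {0..1}"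
    using J by (auto simp: closure_of_subtopology Int_absorb1)
  ultimately show ?thesis
    using closure_of_mono by fastforce
qed

lemma edge_in_int_graph:
  assumes G: "surface_graph S G \<phi>" and H: "subgraph H G" and F: "F \<in> faces S H \<phi>"
    and e: "e \<in> edges G" "e \<notin> edges H"
    and v: "v \<in> set_uprod (ends G e)" "v \<notin> verts H" "v \<in> verts (int_graph S G \<phi> F)"
  shows "e \<in> edges (int_graph S G \<phi> F)"
proof -
  have mG: "multigraph G" and emb: "embedding_map (realisation G) S \<phi>"
    using G by (auto simp: surface_graph_def)
  have inj: "inj_on \<phi> (points G)"
    using emb by (simp add: embedding_map_def homeomorphic_eq_everything_map topspace_realisation[OF mG])
  have HG: "points H \<subseteq> points G"
    using H by (auto simp: subgraph_def points_def)
  have vG: "v \<in> verts G" and vcl: "\<phi> (Inl v) \<in> S closure_of F"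
    using v(3) by (auto simp: int_graph_def)
  have cont: "continuous_map (realisation G) S \<phi>"
    using emb by (auto simp: embedding_map_def homeomorphic_eq_everything_map continuous_map_in_subtopology)
  define g where "g = (\<lambda>t. \<phi> (glue G (Inr (e, t))))"
  have g: "continuous_map (top_of_set {0..1}) S g"
    using continuous_map_compose[OF continuous_map_glue_edge[OF mG e(1)] cont]
    by (simp add: g_def o_def)
  \<comment> \<open>Injectivity of \<phi> on \<open>points G\<close> turns missing
    \<open>points H\<close> in the realisation into missing the drawing of \<open>H\<close> in the
    surface.\<close>
  have avoid: "g t \<notin> \<phi> ` points H" if "t \<in> {0..1}" "glue G (Inr (e, t)) \<notin> points H" for t
    using inj HG glue_in_points[OF mG e(1) that(1)] that(2) unfolding g_def
    by (metis inj_on_image_mem_iff)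
  have inner: "glue G (Inr (e, t)) \<notin> points H" if "0 < t" "t < 1" for t
    using that e(2) by (auto simp: points_def)
  have vH: "Inl v \<notin> points H"
    using v(2) by (auto simp: points_def)
  then have "\<phi> (Inl v) \<notin> \<phi> ` points H"
    using inj HG vG by (subst inj_on_image_mem_iff) (auto simp: points_def)
  then have vF: "\<phi> (Inl v) \<in> F"
    using face_closure_diff_subset[OF F] vcl by blast
  have "set_uprod (ends G e) = {fst (orient (ends G e)), snd (orient (ends G e))}"
    by (metis Upair_orient set_uprod_simps)
  \<comment> \<open>The parametrisation may start or finish at \<open>v\<close>. Only the parameter
    of the opposite end is dropped, giving \<open>{0..<1}\<close> or \<open>{0<..1}\<close>; for a
    loop either choice works.\<close>
  then consider "v = fst (orient (ends G e))" | "v = snd (orient (ends G e))"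
    using v(1) by auto
  then have "g ` {0..1} \<subseteq> S closure_of F"
  proof cases
    case 1
    then have g0: "glue G (Inr (e, 0)) = Inl v"
      by simp
    have "g t \<notin> \<phi> ` points H" if "t \<in> {0..<1}" for t
    proof (rule avoid)
      show "glue G (Inr (e, t)) \<notin> points H"
        using that g0 inner vH by (cases "t = 0") (auto simp del: glue.simps)
    qed (use that in auto)
    then have disj: "g ` {0..<1} \<inter> \<phi> ` points H = {}"
      by blast
    have "g 0 \<in> F"
      using g0 vF by (simp add: g_def del: glue.simps)
    moreover have "g 0 \<in> g ` {0..<1}"
      by (rule imageI) simp
    ultimately have "g ` {0..<1} \<inter> F \<noteq> {}"
      by blast
    with disj show ?thesis
      by (intro path_closure_subset_face_closure[OF g F, of "{0..<1}"]) auto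
  next
    case 2
    then have g1: "glue G (Inr (e, 1)) = Inl v"
      by simp
    have "g t \<notin> \<phi> ` points H" if "t \<in> {0<..1}" for t
    proof (rule avoid)
      show "glue G (Inr (e, t)) \<notin> points H"
        using that g1 inner vH by (cases "t = 1") (auto simp del: glue.simps)
    qed (use that in auto)
    then have disj: "g ` {0<..1} \<inter> \<phi> ` points H = {}"
      by blast
    have "g 1 \<in> F"
      using g1 vF by (simp add: g_def del: glue.simps)
    moreover have "g 1 \<in> g ` {0<..1}"
      by (rule imageI) simp
    ultimately have "g ` {0<..1} \<inter> F \<noteq> {}"
      by blast
    with disj show ?thesis
      by (intro path_closure_subset_face_closure[OF g F, of "{0<..1}"]) auto
  qed
  then show ?thesis
    using e(1) by (simp add: int_graph_def edge_points_def g_def image_image del: glue.simps)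
qed

text \<open>Inclusion-exclusion: the two sets on the left have union \<open>C\<close> and
  intersection \<open>A\<close>.\<close>

lemma card_Un_plus_card_Diff:
  assumes "finite C" "A \<subseteq> C" "B \<subseteq> C"
  shows "card (A \<union> B) + card (C - (B - A)) = card A + card C"
proof -
  have "(A \<union> B) \<union> (C - (B - A)) = C" "(A \<union> B) \<inter> (C - (B - A)) = A"
    using assms by auto
  then show ?thesis
    using card_Un_Int[of "A \<union> B" "C - (B - A)"] assms finite_subset[of _ C] by simp
qed

text \<open>The cardinality identity is applied to vertices and edges separately. Incidences do not
  enter \<open>gamma\<close>, so \<open>L\<close> need not be known to be a graph here.\<close>

lemma gamma_graph_union:
  assumes G: "multigraph G" and H: "subgraph H G"
    and K: "verts K \<subseteq> verts G" "edges K \<subseteq> edges G"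
    and L: "verts L = verts G - (verts K - verts H)" "edges L = edges G - (edges K - edges H)"
  shows "gamma (graph_union H K) + gamma L = gamma H + gamma G"
  using card_Un_plus_card_Diff[of "verts G" "verts H" "verts K"]
    card_Un_plus_card_Diff[of "edges G" "edges H" "edges K"] assms
  by (simp add: gamma_def graph_union_def multigraph_def subgraph_def)

theorem theorem3p4:
  fixes S :: "'a topology"
    and G H :: "('v, 'e) mgraph"
    and \<phi> :: "'v + 'e \<times> real \<Rightarrow> 'a"
    and l :: int
    and F :: "'a set"
  assumes "closed_surface S"
    and "l \<le> 2"
    and "surface_graph S G \<phi>"
    and "tight l G"
    and "subgraph H G"
    and "verts H \<noteq> {} \<or> l \<le> 0"
    and "F \<in> faces S H \<phi>"
  shows "gamma (graph_union H (int_graph S G \<phi> F)) \<le> gamma H"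
proof -
  define K where "K = int_graph S G \<phi> F"
  define L where "L = \<lparr>verts = verts G - (verts K - verts H),
    edges = edges G - (edges K - edges H), ends = ends G\<rparr>"
  have mG: "multigraph G"
    using assms(3) by (simp add: surface_graph_def)
  have ends_L: "set_uprod (ends G e) \<subseteq> verts L" if e: "e \<in> edges L" for e
  proof
    fix v assume v: "v \<in> set_uprod (ends G e)"
    have eG: "e \<in> edges G"
      using e by (simp add: L_def)
    then have vG: "v \<in> verts G"
      using v mG by (auto simp: multigraph_def)
    show "v \<in> verts L"
    proof (cases "e \<in> edges H")
      case True
      then have "v \<in> verts H"
        using v assms(5) by (force simp: subgraph_def multigraph_def)
      then show ?thesis
        using vG by (simp add: L_def)
    next
      case False
      \<comment> \<open>An edge of \<open>L\<close> outside \<open>H\<close> is also outside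
        \<open>K\<close>, so the contrapositive of \<open>edge_in_int_graph\<close> applies to each
        of its ends.\<close>
      then have "v \<in> verts H \<or> v \<notin> verts K"
        using edge_in_int_graph[OF assms(3,5,7) eG _ v] e by (auto simp: L_def K_def)
      then show ?thesis
        using vG by (auto simp: L_def)
    qed
  qed
  then have L: "subgraph L G"
    using mG by (auto simp: subgraph_def multigraph_def L_def)
  have "l \<le> gamma L"
  \<comment> \<open>Sparsity bounds \<open>gamma\<close> only for subgraphs with a vertex. If
    \<open>L\<close> has none, then neither has \<open>H\<close>, and the hypothesis leaves
    \<open>l \<le> 0 = gamma L\<close>.\<close>
  proof (cases "verts L = {}")
    case True
    \<comment> \<open>An edge has at least one end, and it would be a vertex of
      \<open>L\<close>.\<close>
    then have "edges L = {}"
      using ends_L Upair_orient by (metis equals0I insert_not_empty set_uprod_simps subset_empty)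
    moreover have "verts H = {}"
      using True assms(5) by (auto simp: L_def subgraph_def)
    ultimately show ?thesis
      using True assms(6) by (simp add: gamma_def)
  next
    case False
    then show ?thesis
      using L assms(4) by (simp add: tight_def sparse_def)
  qed
  moreover have "gamma (graph_union H K) + gamma L = gamma H + gamma G"
    using mG assms(5) by (rule gamma_graph_union) (auto simp: K_def L_def int_graph_def)
  ultimately show ?thesis
    using assms(4) by (simp add: tight_def K_def)
qed

end
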